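(* For every real number $N$ the following hold, where for each integer $k\ge 1$ we put $J_k=\{-(2k-2),-(2k-4),\ldots,-2,0,2,\ldots,2k-4,2k-2\}$ (the even integers $j$ with $|j|\le 2k-2$) and $F_k(N)=2-\min_{j\in J_k}|N-j|$. (i) For every integer $k\ge 1$, $$f_N(2k+1,2k,1)=F_k(N).$$ (ii) For all integers $k\ge 1$ and $x\ge 2k+2$, $$f_N(x,2k,1)=\max\{F_k(N),\,-2k+|N|\}+x-2k-1.$$ (iii) For all integers $k\ge 1$ and $x\ge 2k+2$, $$f_N(x,2k+1,1)=\max\{F_k(N),\,-(2k-2)+|N|\}+x-2k-2.$$
   Context: Scoring Nim: fix a real number $N$. A position is a tuple $\boldsymbol p=(p_1,\ldots,p_n)$ of non-negative integers (pile sizes), and $|\boldsymbol p|=\sum_i p_i$. Two players alternate; a move $\boldsymbol p\to\boldsymbol p'$ replaces exactly one coordinate $p_i$ by a strictly smaller non-negative integer. A player gets 1 point per stone taken, and the player taking the last stone gets $N$ additional points. The payoff function $f_N$ (score difference, player to move minus opponent, under optimal play) is defined recursively by $f_N(\boldsymbol 0)=-N$ for the terminal position $\boldsymbol 0=(0,\ldots,0)$, and, for $\boldsymbol p\neq\boldsymbol 0$, $f_N(\boldsymbol p)=\max_{\boldsymbol p\to\boldsymbol p'}\{|\boldsymbol p|-|\boldsymbol p'|-f_N(\boldsymbol p')\}$. *)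

theory Defs
  imports Complex_Main
begin

definition nim_move :: "nat list \<Rightarrow> nat list \<Rightarrow> bool" where
  "nim_move p p' \<longleftrightarrow> (\<exists>i<length p. \<exists>m<p ! i. p' = p[i := m])"

lemma nim_move_sum_list_less:
  assumes "nim_move p p'"
  shows "sum_list p' < sum_list p"
proof -
  obtain i m where i: "i < length p" and m: "m < p ! i" and p': "p' = p[i := m]"
    using assms unfolding nim_move_def by blast
  have "p ! i \<le> sum_list p"
    using i by (rule elem_le_sum_list)
  then show ?thesis
    using i m p' by (simp add: sum_list_update)
qed

(* The successors of a position are finite in number, and a nonterminal position has one, so the
   maximum in the payoff recursion below is that of a finite nonempty set. *)
lemma finite_nim_successors: "finite {p'. nim_move p p'}"
proof -
  have "{p'. nim_move p p'} = (\<Union>i<length p. (\<lambda>m. p[i := m]) ` {..<p ! i})"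
    unfolding nim_move_def by auto
  then show ?thesis
    by simp
qed

lemma nim_successors_empty_iff: "{p'. nim_move p p'} = {} \<longleftrightarrow> (\<forall>x\<in>set p. x = 0)"
proof -
  have "{p'. nim_move p p'} = {} \<longleftrightarrow> (\<forall>i<length p. \<forall>m. \<not> m < p ! i)"
    unfolding nim_move_def by blast
  also have "\<dots> \<longleftrightarrow> (\<forall>i<length p. p ! i = 0)"
  proof -
    have "(\<forall>m. \<not> m < n) \<longleftrightarrow> n = 0" for n :: nat
      by (cases n) auto
    then show ?thesis
      by simp
  qed
  also have "\<dots> \<longleftrightarrow> (\<forall>x\<in>set p. x = 0)"
    by (simp only: all_set_conv_all_nth)
  finally show ?thesis .
qed

function payoff :: "real \<Rightarrow> nat list \<Rightarrow> real" where
  "payoff N p =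
    (if \<forall>x\<in>set p. x = 0 then - N
     else Max ((\<lambda>p'. real (sum_list p) - real (sum_list p') - payoff N p') ` {p'. nim_move p p'}))"
  by pat_completeness auto
termination
  by (relation "Wellfounded.measure (\<lambda>(N, p). sum_list p)")
     (auto dest: nim_move_sum_list_less)

(* The defining equation loops as an unconditional rewrite rule. *)
declare payoff.simps [simp del]

definition J :: "nat \<Rightarrow> int set" where
  "J k = {j. even j \<and> \<bar>j\<bar> \<le> 2 * int k - 2}"

definition F :: "nat \<Rightarrow> real \<Rightarrow> real" where
  "F k N = 2 - Min ((\<lambda>j. \<bar>N - real_of_int j\<bar>) ` J k)"

lemma finite_J: "finite (J k)"
  by (rule finite_subset[of _ "{- (2 * int k - 2)..2 * int k - 2}"]) (auto simp: J_def)

lemma J_nonempty: "k \<ge> 1 \<Longrightarrow> J k \<noteq> {}"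
  unfolding J_def by (auto intro!: exI[of _ 0])

end

theory Submission
  imports Defs
begin

text \<open>For \<open>x > y\<close> and \<open>x \<ge> 2\<close>, the position \<open>[x, y, 1]\<close> has payoff \<open>x - y - 1 + E y\<close>, where
  \<open>E\<close> (\<open>excess\<close> below) depends on the smaller pile only; the sole exceptions are the positions
  \<open>[2 k + 1, 2 k, 1]\<close>, of payoff \<open>F k\<close>. A best move reduces the largest pile, and reducing it to
  \<open>m < 2 * (y div 2)\<close> is worth \<open>x - y - 1 + (2 - E m)\<close>. The theorem then comes down to
  \<open>F k = Max {2 - E m | m < 2 k}\<close>, where the maximum is attained at the \<open>m = 2 i < 2 k\<close>
  closest to \<open>\<bar>N\<bar>\<close>. The only other moves that can be best are \<open>m = 2 k\<close> when \<open>y = 2 k + 1\<close> and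
  \<open>m = 2 k + 1\<close> when \<open>y = 2 k\<close>: they leave \<open>F k\<close> to the opponent and account for the second
  arguments of the maxima.\<close>

section \<open>Moves and symmetry for three piles\<close>

lemma nim_successors_triple:
  "{p'. nim_move [x, y, z] p'} =
    (\<lambda>m. [m, y, z]) ` {..<x} \<union> (\<lambda>m. [x, m, z]) ` {..<y} \<union> (\<lambda>m. [x, y, m]) ` {..<z}"
proof -
  have "(\<exists>i<Suc (Suc (Suc 0)). Q i) \<longleftrightarrow> Q 0 \<or> Q 1 \<or> Q 2" for Q
    by (auto simp: less_Suc_eq numeral_2_eq_2)
  then show ?thesis
    by (auto simp: nim_move_def)
qed

lemma payoff_triple:
  assumes "0 < x + y + z"
  shows "payoff N [x, y, z] =
    Max ((\<lambda>m. real x - real m - payoff N [m, y, z]) ` {..<x} \<union>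
         (\<lambda>m. real y - real m - payoff N [x, m, z]) ` {..<y} \<union>
         (\<lambda>m. real z - real m - payoff N [x, y, m]) ` {..<z})"
proof -
  have "\<not> (\<forall>n\<in>set [x, y, z]. n = 0)"
    using assms by auto
  then have "payoff N [x, y, z] =
      Max ((\<lambda>p'. real (sum_list [x, y, z]) - real (sum_list p') - payoff N p') `
        {p'. nim_move [x, y, z] p'})"
    by (subst payoff.simps) (simp only: if_False)
  then show ?thesis
    by (simp only: nim_successors_triple image_Un image_image) (simp add: algebra_simps)
qed

text \<open>A transposition only permutes the three families of options, whose values agree by
  induction. These two transpositions generate all reorderings.\<close>

lemma payoff_triple_swap:
  "payoff N [x, y, z] = payoff N [y, x, z] \<and> payoff N [x, y, z] = payoff N [x, z, y]"
proof (induction "x + y + z" arbitrary: x y z rule: less_induct)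
  case less
  show ?case
  proof (cases "x + y + z = 0")
    case True
    then show ?thesis by simp
  next
    case False
    have 1: "payoff N [m, y, z] = payoff N [y, m, z]" "payoff N [m, y, z] = payoff N [m, z, y]"
      if "m < x" for m using less[of m y z] that by auto
    have 2: "payoff N [x, m, z] = payoff N [m, x, z]" "payoff N [x, m, z] = payoff N [x, z, m]"
      if "m < y" for m using less[of x m z] that by auto
    have 3: "payoff N [x, y, m] = payoff N [y, x, m]" "payoff N [x, y, m] = payoff N [x, m, y]"
      if "m < z" for m using less[of x y m] that by auto
    let ?X = "(\<lambda>m. real x - real m - payoff N [m, y, z]) ` {..<x}"
    let ?Y = "(\<lambda>m. real y - real m - payoff N [x, m, z]) ` {..<y}"
    let ?Z = "(\<lambda>m. real z - real m - payoff N [x, y, m]) ` {..<z}"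
    have "payoff N [x, y, z] = Max (?X \<union> ?Y \<union> ?Z)"
      using False by (intro payoff_triple) simp
    moreover have "payoff N [y, x, z] = Max (?Y \<union> ?X \<union> ?Z)"
      using False 1(1) 2(1) 3(1) by (subst payoff_triple) (simp_all add: disj_ac)
    moreover have "payoff N [x, z, y] = Max (?X \<union> ?Z \<union> ?Y)"
      using False 1(2) 2(2) 3(2) by (subst payoff_triple) (simp_all add: disj_ac)
    ultimately show ?thesis
      by (simp add: Un_ac)
  qed
qed

lemma payoff_swap12: "payoff N [x, y, z] = payoff N [y, x, z]"
  and payoff_swap23: "payoff N [x, y, z] = payoff N [x, z, y]"
  using payoff_triple_swap by blast+

lemma payoff_triple_eqI:
  assumes "\<And>m. m < x \<Longrightarrow> real x - real m - payoff N [m, y, z] \<le> v"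
    and "\<And>m. m < y \<Longrightarrow> real y - real m - payoff N [x, m, z] \<le> v"
    and "\<And>m. m < z \<Longrightarrow> real z - real m - payoff N [x, y, m] \<le> v"
    and "(\<exists>m<x. v = real x - real m - payoff N [m, y, z]) \<or>
         (\<exists>m<y. v = real y - real m - payoff N [x, m, z]) \<or>
         (\<exists>m<z. v = real z - real m - payoff N [x, y, m])"
  shows "payoff N [x, y, z] = v"
proof -
  \<comment> \<open>The option attaining \<open>v\<close> shows that the position is not
    terminal.\<close>
  have "0 < x + y + z"
    using assms(4) by auto
  then show ?thesis
    by (subst payoff_triple, simp, intro Max_eqI) (use assms in auto)
qed

section \<open>Positions with at most two nonempty piles\<close>

lemma payoff_0: "payoff N [0, 0, 0] = - N"
  by (simp add: payoff.simps)

lemma payoff_1: "payoff N [1, 0, 0] = 1 + N"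
  by (rule payoff_triple_eqI) (auto simp: payoff_0)

text \<open>The best moves take everything, worth \<open>x + N\<close>, or leave one stone, worth
  \<open>x - 2 - N\<close>.\<close>

lemma payoff_one_pile: "2 \<le> x \<Longrightarrow> payoff N [x, 0, 0] = real x - 1 + \<bar>N + 1\<bar>"
proof (induction x rule: less_induct)
  case (less x)
  note small = payoff_0[of N] payoff_1[of N]
  show ?case
  proof (rule payoff_triple_eqI)
    fix m assume m: "m < x"
    consider "m = 0" | "m = 1" | "2 \<le> m" by linarith
    then show "real x - real m - payoff N [m, 0, 0] \<le> real x - 1 + \<bar>N + 1\<bar>"
    proof cases
      case 3
      then have "2 \<le> real m" by simp
      then show ?thesis using less.IH[OF m 3] by linarith
    qed (use small in auto)
  next
    show "(\<exists>m<x. real x - 1 + \<bar>N + 1\<bar> = real x - real m - payoff N [m, 0, 0]) \<or>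
      (\<exists>m<0. real x - 1 + \<bar>N + 1\<bar> = real 0 - real m - payoff N [x, m, 0]) \<or>
      (\<exists>m<0. real x - 1 + \<bar>N + 1\<bar> = real 0 - real m - payoff N [x, 0, m])"
    proof (rule disjI1, cases "N + 1 \<ge> 0")
      case True
      then show "\<exists>m<x. real x - 1 + \<bar>N + 1\<bar> = real x - real m - payoff N [m, 0, 0]"
        by (intro exI[of _ 0]) (use small less.prems in auto)
    next
      case False
      then show "\<exists>m<x. real x - 1 + \<bar>N + 1\<bar> = real x - real m - payoff N [m, 0, 0]"
        by (intro exI[of _ 1]) (use small less.prems in auto)
    qed
  qed auto
qed

lemma payoff_1_1: "payoff N [1, 1, 0] = - N"
  by (rule payoff_triple_eqI) (auto simp: payoff_1[simplified] payoff_swap12[of N 0])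

text \<open>Reducing the large pile to 1 is worth \<open>x - 1 + N\<close>, emptying it
  \<open>x - 1 - N\<close>.\<close>

lemma payoff_pile_1: "2 \<le> x \<Longrightarrow> payoff N [x, 1, 0] = real x - 1 + \<bar>N\<bar>"
proof (induction x rule: less_induct)
  case (less x)
  note small = payoff_1_1[of N] payoff_1[of N] payoff_swap12[of N 0 1]
  note one = payoff_one_pile[OF less.prems, of N]
  show ?case
  proof (rule payoff_triple_eqI)
    fix m assume m: "m < x"
    consider "m = 0" | "m = 1" | "2 \<le> m" by linarith
    then show "real x - real m - payoff N [m, 1, 0] \<le> real x - 1 + \<bar>N\<bar>"
      by cases (use small less m in auto)
  next
    fix m :: nat assume "m < 1"
    then show "real 1 - real m - payoff N [x, m, 0] \<le> real x - 1 + \<bar>N\<bar>"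
      using one less.prems by auto
  next
    show "(\<exists>m<x. real x - 1 + \<bar>N\<bar> = real x - real m - payoff N [m, 1, 0]) \<or>
      (\<exists>m<1. real x - 1 + \<bar>N\<bar> = real 1 - real m - payoff N [x, m, 0]) \<or>
      (\<exists>m<0. real x - 1 + \<bar>N\<bar> = real 0 - real m - payoff N [x, 1, m])"
    proof (rule disjI1, cases "N \<ge> 0")
      case True
      then show "\<exists>m<x. real x - 1 + \<bar>N\<bar> = real x - real m - payoff N [m, 1, 0]"
        by (intro exI[of _ 1]) (use small less.prems in auto)
    next
      case False
      then show "\<exists>m<x. real x - 1 + \<bar>N\<bar> = real x - real m - payoff N [m, 1, 0]"
        by (intro exI[of _ 0]) (use small less.prems in auto)
    qed
  qed auto
qed

text \<open>From equal piles the best move empties one. Otherwise the larger pile is emptied or made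
  equal to the other; these two options differ only in the sign of
  \<open>1 - \<bar>N + 1\<bar>\<close>.\<close>

lemma payoff_two_piles:
  assumes "2 \<le> y" and "y \<le> x"
  shows "payoff N [x, y, 0] =
    (if x = y then 1 - \<bar>N + 1\<bar> else real x - real y + \<bar>1 - \<bar>N + 1\<bar>\<bar>)"
  using assms
proof (induction "x + y" arbitrary: x y rule: less_induct)
  case less
  have y: "2 \<le> y" and x: "y \<le> x" by fact+
  have eq: "payoff N [n, n, 0] = 1 - \<bar>N + 1\<bar>" if "2 \<le> n" "n + n < x + y" for n
    using less.hyps[of n n] that by simp
  have gt: "payoff N [n, m, 0] = real n - real m + \<bar>1 - \<bar>N + 1\<bar>\<bar>"
    if "2 \<le> m" "m < n" "n + m < x + y" for n m
    using less.hyps[of n m] that by simp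
  have lo: "payoff N [n, 0, 0] = real n - 1 + \<bar>N + 1\<bar>" "payoff N [n, 1, 0] = real n - 1 + \<bar>N\<bar>"
    "payoff N [0, n, 0] = real n - 1 + \<bar>N + 1\<bar>" "payoff N [1, n, 0] = real n - 1 + \<bar>N\<bar>"
    if "2 \<le> n" for n
    using that payoff_one_pile payoff_pile_1 payoff_swap12 by metis+
  have cases3: "m = 0 \<or> m = 1 \<or> 2 \<le> m" for m :: nat
    by linarith
  show ?case
  proof (cases "x = y")
    case True
    have le: "real y - real m - payoff N [y, m, 0] \<le> 1 - \<bar>N + 1\<bar>" if "m < y" for m
      using cases3[of m] lo[OF y] gt[of m y] that True by auto
    have "payoff N [y, y, 0] = 1 - \<bar>N + 1\<bar>"
    proof (rule payoff_triple_eqI)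
      show "real y - real m - payoff N [m, y, 0] \<le> 1 - \<bar>N + 1\<bar>" if "m < y" for m
        using le[OF that] payoff_swap12[of N m y] by simp
      show "(\<exists>m<y. 1 - \<bar>N + 1\<bar> = real y - real m - payoff N [m, y, 0]) \<or>
          (\<exists>m<y. 1 - \<bar>N + 1\<bar> = real y - real m - payoff N [y, m, 0]) \<or>
          (\<exists>m<0. 1 - \<bar>N + 1\<bar> = real 0 - real m - payoff N [y, y, m])"
        by (intro disjI1 exI[of _ 0]) (use y lo[OF y] in auto)
    qed (use le in auto)
    then show ?thesis
      using True by simp
  next
    case False
    with x have xy: "y < x" by simp
    let ?v = "real x - real y + \<bar>1 - \<bar>N + 1\<bar>\<bar>"
    have "payoff N [x, y, 0] = ?v"
    proof (rule payoff_triple_eqI)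
      fix m assume m: "m < x"
      show "real x - real m - payoff N [m, y, 0] \<le> ?v"
      proof (cases m y rule: linorder_cases)
        case less
        then show ?thesis
          using cases3[of m] lo[OF y] gt[of m y] payoff_swap12[of N m y] xy by auto
      next
        case equal
        then show ?thesis using eq[of y] y xy by auto
      next
        case greater
        then have "payoff N [m, y, 0] = real m - real y + \<bar>1 - \<bar>N + 1\<bar>\<bar>" "real y < real m"
          using gt[of y m] y m by simp_all
        then show ?thesis by linarith
      qed
    next
      fix m assume m: "m < y"
      have "real y < real x" using xy by simp
      \<comment> \<open>A crude bound suffices: the option is then worth at most
        \<open>y - x + 1\<close>, which is not positive.\<close>
      moreover have "payoff N [x, m, 0] \<ge> real x - real m - 1"
        using cases3[of m] lo[of x] gt[of m x] xy y m by auto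
      ultimately show "real y - real m - payoff N [x, m, 0] \<le> ?v"
        using xy by linarith
    next
      show "(\<exists>m<x. ?v = real x - real m - payoff N [m, y, 0]) \<or>
          (\<exists>m<y. ?v = real y - real m - payoff N [x, m, 0]) \<or>
          (\<exists>m<0. ?v = real 0 - real m - payoff N [x, y, m])"
      proof (rule disjI1, cases "\<bar>N + 1\<bar> \<le> 1")
        case True
        then show "\<exists>m<x. ?v = real x - real m - payoff N [m, y, 0]"
          by (intro exI[of _ 0]) (use lo[OF y] y xy in auto)
      next
        case False
        then show "\<exists>m<x. ?v = real x - real m - payoff N [m, y, 0]"
          by (intro exI[of _ y]) (use eq[of y] y xy in auto)
      qed
    qed simp
    then show ?thesis
      using False by simp
  qed
qed

section \<open>The distance from \<open>N\<close> to the even integers in \<open>J k\<close>\<close>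

lemma F_ge:
  assumes "i < k"
  shows "2 - \<bar>\<bar>N\<bar> - 2 * real i\<bar> \<le> F k N"
proof -
  \<comment> \<open>Giving \<open>j\<close> the sign of \<open>N\<close> turns the distance to
    \<open>N\<close> into one between absolute values.\<close>
  define j :: int where "j = (if N \<ge> 0 then 2 * int i else - 2 * int i)"
  have "j \<in> J k"
    using assms by (auto simp: J_def j_def)
  then have "Min ((\<lambda>j. \<bar>N - real_of_int j\<bar>) ` J k) \<le> \<bar>N - real_of_int j\<bar>"
    by (intro Min_le) (auto simp: finite_J)
  also have "\<dots> = \<bar>\<bar>N\<bar> - 2 * real i\<bar>"
    by (auto simp: j_def)
  finally show ?thesis
    by (simp add: F_def)
qed

lemma F_attained:
  assumes "1 \<le> k"
  obtains i where "i < k" and "F k N = 2 - \<bar>\<bar>N\<bar> - 2 * real i\<bar>"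
proof -
  have "Min ((\<lambda>j. \<bar>N - real_of_int j\<bar>) ` J k) \<in> (\<lambda>j. \<bar>N - real_of_int j\<bar>) ` J k"
    using assms by (intro Min_in) (auto simp: finite_J J_nonempty)
  then obtain j where j: "j \<in> J k" and F: "F k N = 2 - \<bar>N - real_of_int j\<bar>"
    by (auto simp: F_def)
  define i where "i = nat \<bar>j\<bar> div 2"
  have ij: "\<bar>j\<bar> = 2 * int i"
    using j by (auto simp: J_def i_def zdiv_int)
  have i: "i < k"
    using j ij assms by (auto simp: J_def)
  have "\<bar>real_of_int j\<bar> = 2 * real i"
    using ij by (metis of_int_abs of_int_mult of_int_numeral of_int_of_nat_eq)
  \<comment> \<open>Only the reverse triangle inequality is at hand, as the signs of
    \<open>j\<close> and \<open>N\<close> may differ; \<open>F_ge\<close> supplies the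
    converse.\<close>
  then have "F k N \<le> 2 - \<bar>\<bar>N\<bar> - 2 * real i\<bar>"
    using F by linarith
  with F_ge[OF i, of N] show ?thesis
    using that i by force
qed

text \<open>The half-open interval makes the even number unique; since \<open>a\<close> is
  non-negative, so is that number. The strict upper bound yields \<open>i < k\<close> in
  \<open>F_ge_1\<close> even for \<open>\<bar>N\<bar> = 2 * k - 1\<close>.\<close>

lemma nearest_even:
  fixes a :: real
  assumes "0 \<le> a"
  obtains i :: nat where "a - 1 \<le> 2 * real i" and "2 * real i < a + 1"
proof -
  define c where "c = \<lceil>(a - 1) / 2\<rceil>"
  have c: "(a - 1) / 2 \<le> real_of_int c" "real_of_int c < (a - 1) / 2 + 1"
    unfolding c_def by linarith+
  then have "-1 < real_of_int c"
    using assms by argo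
  then have "real (nat c) = real_of_int c"
    by simp
  with c that[of "nat c"] show ?thesis
    by argo
qed

lemma F_ge_1:
  assumes "\<bar>N\<bar> \<le> 2 * real k - 1"
  shows "1 \<le> F k N"
proof -
  obtain i :: nat where i: "\<bar>N\<bar> - 1 \<le> 2 * real i" "2 * real i < \<bar>N\<bar> + 1"
    using nearest_even[of "\<bar>N\<bar>"] by auto
  then have "i < k"
    using assms by linarith
  from F_ge[OF this, of N] show ?thesis
    using i by linarith
qed

text \<open>The nearest element of \<open>J k\<close> is now an endpoint. Together with
  \<open>F_ge_1\<close> this covers all \<open>N\<close>, which underlies the later case
  distinctions.\<close>

lemma F_outside:
  assumes "1 \<le> k" and "2 * real k - 2 \<le> \<bar>N\<bar>"
  shows "F k N = 2 * real k - \<bar>N\<bar>"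
proof -
  obtain i where i: "i < k" "F k N = 2 - \<bar>\<bar>N\<bar> - 2 * real i\<bar>"
    using F_attained[OF assms(1)] .
  then have "real i \<le> real k - 1"
    by linarith
  moreover have "2 - \<bar>\<bar>N\<bar> - 2 * real (k - 1)\<bar> \<le> F k N"
    using assms by (intro F_ge) simp
  ultimately show ?thesis
    using i(2) assms by (simp add: of_nat_diff)
qed

lemma F_ge_2_minus_abs:
  assumes "1 \<le> k"
  shows "2 - \<bar>N\<bar> \<le> F k N"
  using F_ge[of 0 k N] assms by simp

section \<open>The excess and its relation to \<open>F\<close>\<close>

text \<open>The piles 0 and 1 need their own values because \<open>J 0\<close> is empty. For
  \<open>y = 2 * k + 1\<close> the constant 3 produces
  \<open>\<bar>N\<bar> - (2 * k - 2)\<close>.\<close>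

definition excess :: "real \<Rightarrow> nat \<Rightarrow> real" where
  "excess N y =
    (if y = 0 then \<bar>N\<bar>
     else if y = 1 then 1 + \<bar>N + 1\<bar>
     else if even y then max (F (y div 2) N) (\<bar>N\<bar> - real y)
     else max (F (y div 2) N) (\<bar>N\<bar> - real y + 3))"

text \<open>In this range \<open>F i N\<close> is \<open>2 * i - \<bar>N\<bar>\<close>, so the
  maximum is taken over a number and its negative.\<close>

lemma excess_even:
  assumes "2 * real i - 2 \<le> \<bar>N\<bar>"
  shows "excess N (2 * i) = \<bar>\<bar>N\<bar> - 2 * real i\<bar>"
proof (cases "i = 0")
  case False
  then show ?thesis
    using F_outside[of i N] assms by (auto simp: excess_def max_def)
qed (simp add: excess_def)

lemma excess_ge_F:
  assumes "2 \<le> m"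
  shows "F (m div 2) N \<le> excess N m"
  using assms by (simp add: excess_def)

lemma excess_even_le_odd:
  assumes "1 \<le> i"
  shows "excess N (2 * i) \<le> excess N (2 * i + 1)"
  using assms by (auto simp: excess_def)

lemma excess_even_nonneg: "0 \<le> excess N (2 * i)"
proof (cases "2 * real i - 2 \<le> \<bar>N\<bar>")
  case False
  then have "real i > 0" and F1: "1 \<le> F i N"
    by (auto intro: F_ge_1)
  then have "1 \<le> i" by simp
  with F1 show ?thesis
    using excess_ge_F[of "2 * i" N] by simp
qed (simp add: excess_even)

lemma excess_odd_ge_1: "1 \<le> excess N (2 * i + 1)"
proof (cases "i = 0")
  case False
  then show ?thesis
    using F_ge_1[of N i] by (cases "\<bar>N\<bar> \<le> 2 * real i - 1") (auto simp: excess_def)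
qed (simp add: excess_def)

lemma excess_nonneg: "0 \<le> excess N m"
proof (cases "even m")
  case True
  then show ?thesis
    using excess_even_nonneg by (auto elim!: evenE)
next
  case False
  then obtain i where "m = 2 * i + 1" by (rule oddE)
  then show ?thesis
    using excess_odd_ge_1[of N i] by simp
qed

text \<open>For large \<open>\<bar>N\<bar>\<close> this is \<open>F_ge\<close>; otherwise
  \<open>F i N\<close> and \<open>F k N\<close> are both at least 1.\<close>

lemma F_ge_excess_even:
  assumes "i < k"
  shows "2 - excess N (2 * i) \<le> F k N"
proof (cases "2 * real i - 2 \<le> \<bar>N\<bar>")
  case True
  then show ?thesis
    using F_ge[OF assms] by (simp add: excess_even)
next
  case False
  then have "real i > 0" and F1: "1 \<le> F i N" "1 \<le> F k N"
    using assms by (auto intro: F_ge_1)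
  then have "1 \<le> i" by simp
  with F1 show ?thesis
    using excess_ge_F[of "2 * i" N] by simp
qed

text \<open>An odd \<open>m\<close> gives no more than \<open>m - 1\<close>: its excess is at least
  as large, by \<open>1 + \<bar>N + 1\<bar> \<ge> \<bar>N\<bar>\<close> when
  \<open>m = 1\<close>.\<close>

lemma F_ge_excess:
  assumes "m < 2 * k"
  shows "2 - excess N m \<le> F k N"
proof (cases "even m")
  case True
  then obtain i where "m = 2 * i" by (rule evenE)
  then show ?thesis
    using F_ge_excess_even[of i k N] assms by simp
next
  case False
  then obtain i where i: "m = 2 * i + 1" by (rule oddE)
  show ?thesis
  proof (cases "i = 0")
    case True
    then show ?thesis
      using F_ge_2_minus_abs[of k N] i assms by (auto simp: excess_def)
  next
    case False
    then show ?thesis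
      using F_ge_excess_even[of i k N] excess_even_le_odd[of i N] i assms by simp
  qed
qed

lemma F_excess_attained:
  assumes "1 \<le> k"
  obtains m where "m < 2 * k" and "F k N = 2 - excess N m"
proof -
  obtain i :: nat where i: "\<bar>N\<bar> - 1 \<le> 2 * real i" "2 * real i < \<bar>N\<bar> + 1"
    using nearest_even[of "\<bar>N\<bar>"] by auto
  show ?thesis
  proof (cases "i < k")
    case True
    obtain l where l: "l < k" "F k N = 2 - \<bar>\<bar>N\<bar> - 2 * real l\<bar>"
      using F_attained[OF assms] .
    \<comment> \<open>By integrality, any other \<open>2 * l\<close> is at least 2 away from
      \<open>2 * i\<close>, hence at least 1 away from \<open>\<bar>N\<bar>\<close>.\<close>
    have "real l = real i \<or> real l \<le> real i - 1 \<or> real i + 1 \<le> real l"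
      by (cases l i rule: linorder_cases) auto
    then have "\<bar>\<bar>N\<bar> - 2 * real i\<bar> \<le> \<bar>\<bar>N\<bar> - 2 * real l\<bar>"
      using i by linarith
    with l(2) F_ge[OF True, of N] have "F k N = 2 - \<bar>\<bar>N\<bar> - 2 * real i\<bar>"
      by linarith
    then show ?thesis
      using that[of "2 * i"] True i by (simp add: excess_even)
  next
    case False
    then have N: "2 * real k - 1 \<le> \<bar>N\<bar>"
      using i by linarith
    have "excess N (2 * (k - 1)) = \<bar>N\<bar> - 2 * real (k - 1)"
      using N assms by (subst excess_even) (auto simp: of_nat_diff)
    then have "F k N = 2 - excess N (2 * (k - 1))"
      using N assms F_outside[of k N] by (simp add: of_nat_diff)
    then show ?thesis
      using that[of "2 * (k - 1)"] assms by simp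
  qed
qed

section \<open>Three piles, two of them single stones\<close>

lemma payoff_1_1_1: "payoff N [1, 1, 1] = 1 + N"
proof -
  have "payoff N [0, 1, 1] = - N" "payoff N [1, 0, 1] = - N"
    using payoff_1_1[of N] payoff_swap12[of N 0 1 1] payoff_swap23[of N 1 0 1] by simp_all
  then show ?thesis
    using payoff_1_1[of N] by (intro payoff_triple_eqI) auto
qed

text \<open>The two single stones cancel: emptying the large pile or leaving one stone of it is
  worth the same as without them.\<close>

lemma payoff_pile_1_1: "2 \<le> x \<Longrightarrow> payoff N [x, 1, 1] = real x - 1 + \<bar>N + 1\<bar>"
proof (induction x rule: less_induct)
  case (less x)
  have small: "payoff N [0, 1, 1] = - N"
    using payoff_1_1[of N] payoff_swap12[of N 0 1 1] payoff_swap23[of N 1 0 1] by simp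
  note ones = payoff_1_1_1[of N]
  note two = payoff_pile_1[OF less.prems, of N] payoff_swap23[of N x 0 1]
  show ?case
  proof (rule payoff_triple_eqI)
    fix m assume m: "m < x"
    consider "m = 0" | "m = 1" | "2 \<le> m" by linarith
    then show "real x - real m - payoff N [m, 1, 1] \<le> real x - 1 + \<bar>N + 1\<bar>"
    proof cases
      case 3
      then have "2 \<le> real m" by simp
      then show ?thesis using less.IH[OF m 3] by linarith
    qed (use small ones in auto)
  next
    show "(\<exists>m<x. real x - 1 + \<bar>N + 1\<bar> = real x - real m - payoff N [m, 1, 1]) \<or>
      (\<exists>m<1. real x - 1 + \<bar>N + 1\<bar> = real 1 - real m - payoff N [x, m, 1]) \<or>
      (\<exists>m<1. real x - 1 + \<bar>N + 1\<bar> = real 1 - real m - payoff N [x, 1, m])"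
    proof (rule disjI1, cases "N + 1 \<ge> 0")
      case True
      then show "\<exists>m<x. real x - 1 + \<bar>N + 1\<bar> = real x - real m - payoff N [m, 1, 1]"
        by (intro exI[of _ 0]) (use small less.prems in auto)
    next
      case False
      then show "\<exists>m<x. real x - 1 + \<bar>N + 1\<bar> = real x - real m - payoff N [m, 1, 1]"
        by (intro exI[of _ 1]) (use ones less.prems in auto)
    qed
  qed (use two less.prems in auto)
qed

lemma excess_even_pile:
  assumes "1 \<le> k"
  shows "excess N (2 * k) = max (F k N) (- 2 * real k + \<bar>N\<bar>)"
  using assms by (simp add: excess_def)

lemma excess_odd_pile:
  assumes "1 \<le> k"
  shows "excess N (2 * k + 1) = max (F k N) (- (2 * real k - 2) + \<bar>N\<bar>)"
  using assms by (simp add: excess_def algebra_simps)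

section \<open>Comparison of the options at \<open>[x, y, 1]\<close>\<close>

text \<open>For even \<open>y\<close> and \<open>x = Suc y\<close>, reducing \<open>x\<close> to
  \<open>Suc y\<close> is not a move, so the second argument of the maximum disappears.\<close>

definition surplus :: "real \<Rightarrow> nat \<Rightarrow> nat \<Rightarrow> real" where
  "surplus N x y = (if even y \<and> x = Suc y then F (y div 2) N else excess N y)"

lemma surplus_ge_F:
  assumes "2 \<le> y"
  shows "F (y div 2) N \<le> surplus N x y"
  using excess_ge_F[OF assms, of N] by (simp add: surplus_def)

text \<open>Either \<open>F k N\<close> is at least 1 and dominates its own reflection, or it is
  \<open>2 * k - \<bar>N\<bar>\<close> and the reflection is the second argument of the
  maximum.\<close>

lemma F_reflect_le_excess:
  assumes "1 \<le> k"
  shows "- F k N \<le> excess N (2 * k)" and "2 - F k N \<le> excess N (2 * k + 1)"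
proof -
  have F: "1 \<le> F k N \<or> F k N = 2 * real k - \<bar>N\<bar>"
    using F_ge_1[of N k] F_outside[OF assms, of N] by linarith
  then show "- F k N \<le> excess N (2 * k)"
    unfolding excess_even_pile[OF assms] by linarith
  show "2 - F k N \<le> excess N (2 * k + 1)"
    using F unfolding excess_odd_pile[OF assms] by linarith
qed

text \<open>Bounds the option of reducing \<open>x\<close> to \<open>m\<close>, worth
  \<open>x - y - 1\<close> plus the left-hand side.\<close>

lemma surplus_ge_pile_less:
  assumes "2 \<le> y" and "y < x" and "m < y"
  shows "2 - surplus N y m \<le> surplus N x y"
proof (cases "m < 2 * (y div 2)")
  case True
  then have "surplus N y m = excess N m"
    by (auto simp: surplus_def)
  then show ?thesis
    using F_ge_excess[OF True, of N] surplus_ge_F[OF assms(1), of N x] by linarith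
next
  case False
  define k where "k = y div 2"
  \<comment> \<open>Only here does the move reach an exceptional position.\<close>
  have "y = 2 * k + 1" "m = 2 * k"
    using False assms(3) unfolding k_def by presburger+
  then show ?thesis
    using F_reflect_le_excess(2)[of k N] assms by (simp add: surplus_def)
qed

text \<open>Bounds the option of reducing the smaller pile to \<open>m\<close>.\<close>

lemma surplus_ge_neg_excess:
  assumes "2 \<le> y" and "y < x" and "m < y"
  shows "- excess N m \<le> surplus N x y"
proof (cases "even y")
  case True
  then show ?thesis
    using F_ge_excess[of m "y div 2" N] surplus_ge_F[OF assms(1), of N x] assms(3) by simp
next
  case False
  then show ?thesis
    using excess_nonneg[of N m] excess_nonneg[of N y] by (simp add: surplus_def)
qed

text \<open>Bounds the option of reducing \<open>x\<close> to \<open>m\<close> above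
  \<open>y\<close>; nothing is lost in the estimate at \<open>m = Suc y\<close>.\<close>

lemma surplus_ge_neg_surplus:
  assumes "2 \<le> y" and "y < m" and "m < x"
  shows "- surplus N m y \<le> surplus N x y"
proof -
  have "surplus N x y = excess N y"
    using assms by (simp add: surplus_def)
  moreover have "- F (y div 2) N \<le> excess N y" if "even y"
    using F_reflect_le_excess(1)[of "y div 2" N] that assms(1) by simp
  ultimately show ?thesis
    using excess_nonneg[of N y] by (auto simp: surplus_def)
qed

text \<open>Handles moves that equalise the piles or remove the single stone, whose values involve
  \<open>\<bar>N + 1\<bar>\<close>, within 1 of \<open>\<bar>N\<bar>\<close>.\<close>

lemma surplus_ge_2_minus_abs:
  assumes "2 \<le> y"
  shows "2 - \<bar>N\<bar> \<le> surplus N x y"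
  using F_ge_2_minus_abs[of "y div 2" N] surplus_ge_F[OF assms, of N x] assms by linarith

lemma surplus_attained:
  assumes "2 \<le> y" and "y < x"
  shows "(\<exists>m<y. surplus N x y = 2 - surplus N y m) \<or>
    (Suc y < x \<and> surplus N x y = - surplus N (Suc y) y)"
proof -
  define k where "k = y div 2"
  have k: "1 \<le> k"
    using assms(1) by (simp add: k_def)
  obtain m where m: "m < 2 * k" "F k N = 2 - excess N m"
    using F_excess_attained[OF k] .
  show ?thesis
  proof (cases "surplus N x y = F k N")
    case True
    have "surplus N y m = excess N m" "m < y"
      using m(1) by (auto simp: surplus_def k_def)
    with True m(2) show ?thesis
      by auto
  next
    case False
    show ?thesis
    proof (cases "even y")
      case True
      then have y: "y = 2 * k" by (simp add: k_def)
      with False assms(2) have "Suc y < x"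
        by (cases "x = Suc y") (simp_all add: surplus_def)
      moreover from this False have "surplus N x y = \<bar>N\<bar> - 2 * real k" "F k N < \<bar>N\<bar> - 2 * real k"
        using k by (auto simp: surplus_def y excess_even_pile max_def split: if_splits)
      \<comment> \<open>A second argument exceeding \<open>F k N\<close> rules out
        \<open>\<bar>N\<bar> \<le> 2 * k - 1\<close>, where \<open>F k N\<close> is at least 1. The
        odd case below argues alike.\<close>
      moreover from this have "F k N = 2 * real k - \<bar>N\<bar>"
        using F_ge_1[of N k] F_outside[OF k, of N] by linarith
      ultimately show ?thesis
        using y by (simp add: surplus_def)
    next
      case odd: False
      then have y: "y = 2 * k + 1" by (simp add: k_def)
      with False have "surplus N x y = \<bar>N\<bar> - 2 * real k + 2" "F k N < \<bar>N\<bar> - 2 * real k + 2"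
        using k excess_odd_pile[OF k, of N] by (auto simp: surplus_def max_def split: if_splits)
      moreover from this have "F k N = 2 * real k - \<bar>N\<bar>"
        using F_ge_1[of N k] F_outside[OF k, of N] by linarith
      ultimately have "surplus N x y = 2 - surplus N y (2 * k)" "2 * k < y"
        using y by (auto simp: surplus_def)
      then show ?thesis
        by blast
    qed
  qed
qed

section \<open>Evaluation of \<open>[x, y, 1]\<close> by induction on the number of stones\<close>

lemma payoff_three_piles:
  assumes "2 \<le> y" and "y \<le> x"
  shows "payoff N [x, y, 1] =
    (if x = y then \<bar>N + 1\<bar> else real x - real y - 1 + surplus N x y)"
  using assms
proof (induction "x + y" arbitrary: x y rule: less_induct)
  case less
  have y: "2 \<le> y" and x: "y \<le> x" by fact+
  have eq: "payoff N [n, n, 1] = \<bar>N + 1\<bar>" if "2 \<le> n" "n + n < x + y" for n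
    using less.hyps[of n n] that by simp
  \<comment> \<open>The induction hypothesis extended to \<open>m = 0\<close> and
    \<open>m = 1\<close>, where \<open>surplus\<close> reproduces the values already
    computed.\<close>
  have gt: "payoff N [n, m, 1] = real n - real m - 1 + surplus N n m"
    if "2 \<le> n" "m < n" "n + m < x + y" for n m
  proof -
    consider "m = 0" | "m = 1" | "2 \<le> m" by linarith
    then show ?thesis
    proof cases
      case 1
      then show ?thesis
        using payoff_pile_1[OF that(1), of N] payoff_swap23[of N n 0 1] that(1)
        by (simp add: surplus_def excess_def)
    next
      case 2
      then show ?thesis
        using payoff_pile_1_1[OF that(1), of N] by (simp add: surplus_def excess_def)
    next
      case 3
      then show ?thesis
        using less.hyps[of n m] that by simp
    qed
  qed
  have two: "payoff N [x, y, 0] =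
      (if x = y then 1 - \<bar>N + 1\<bar> else real x - real y + \<bar>1 - \<bar>N + 1\<bar>\<bar>)"
    using payoff_two_piles[OF y x] .
  show ?case
  proof (cases "x = y")
    case True
    have le: "real y - real m - payoff N [y, m, 1] \<le> \<bar>N + 1\<bar>" if "m < y" for m
    proof -
      \<comment> \<open>With equal piles, reducing one of them to \<open>m\<close> is worth exactly
        the left-hand side.\<close>
      have "1 - surplus N y m \<le> \<bar>N + 1\<bar>"
      proof -
        consider "m = 0" | "m = 1" | "2 \<le> m" by linarith
        then show ?thesis
        proof cases
          case 3
          then show ?thesis using surplus_ge_2_minus_abs[of m N y] by linarith
        qed (use y in \<open>auto simp: surplus_def excess_def\<close>)
      qed
      then show ?thesis
        using gt[of y m] that True y by simp
    qed
    have "payoff N [y, y, 1] = \<bar>N + 1\<bar>"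
    proof (rule payoff_triple_eqI)
      show "real y - real m - payoff N [m, y, 1] \<le> \<bar>N + 1\<bar>" if "m < y" for m
        using le[OF that] payoff_swap12[of N m y] by simp
      \<comment> \<open>The value is attained by removing the single stone.\<close>
      show "(\<exists>m<y. \<bar>N + 1\<bar> = real y - real m - payoff N [m, y, 1]) \<or>
          (\<exists>m<y. \<bar>N + 1\<bar> = real y - real m - payoff N [y, m, 1]) \<or>
          (\<exists>m<1. \<bar>N + 1\<bar> = real 1 - real m - payoff N [y, y, m])"
        using two True by auto
    qed (use le two True in auto)
    then show ?thesis
      using True by simp
  next
    case False
    with x have xy: "y < x" by simp
    let ?v = "real x - real y - 1 + surplus N x y"
    have less: "payoff N [m, y, 1] = real y - real m - 1 + surplus N y m" if "m < y" for m
      using gt[of y m] payoff_swap12[of N m y] that y xy by simp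
    have eqy: "payoff N [y, y, 1] = \<bar>N + 1\<bar>"
      using eq[OF y] xy by simp
    have "payoff N [x, y, 1] = ?v"
    proof (rule payoff_triple_eqI)
      fix m assume m: "m < x"
      show "real x - real m - payoff N [m, y, 1] \<le> ?v"
      proof (cases m y rule: linorder_cases)
        case l: less
        then show ?thesis
          using less surplus_ge_pile_less[OF y xy l, of N] by simp
      next
        case equal
        then show ?thesis
          using eqy surplus_ge_2_minus_abs[OF y, of N x] by simp
      next
        case greater
        then have "real y + 1 \<le> real m"
          by linarith
        then show ?thesis
          using gt[of m y] greater y m surplus_ge_neg_surplus[OF y greater m, of N] by simp
      qed
    next
      fix m assume m: "m < y"
      moreover have "surplus N x m = excess N m"
        using m xy by (simp add: surplus_def)
      moreover have "real y + 1 \<le> real x"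
        using xy by linarith
      ultimately show "real y - real m - payoff N [x, m, 1] \<le> ?v"
        using gt[of x m] xy y surplus_ge_neg_excess[OF y xy m, of N] by simp
    next
      fix m :: nat assume "m < 1"
      moreover have "real y + 1 \<le> real x"
        using xy by linarith
      ultimately show "real 1 - real m - payoff N [x, y, m] \<le> ?v"
        using two False surplus_ge_2_minus_abs[OF y, of N x] by simp
    next
      show "(\<exists>m<x. ?v = real x - real m - payoff N [m, y, 1]) \<or>
          (\<exists>m<y. ?v = real y - real m - payoff N [x, m, 1]) \<or>
          (\<exists>m<1. ?v = real 1 - real m - payoff N [x, y, m])"
        using surplus_attained[OF y xy, of N]
      proof (elim disjE exE conjE)
        fix m assume "m < y" "surplus N x y = 2 - surplus N y m"
        then show ?thesis
          using less[of m] xy by (intro disjI1 exI[of _ m]) simp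
      next
        assume "Suc y < x" "surplus N x y = - surplus N (Suc y) y"
        then show ?thesis
          using gt[of "Suc y" y] y by (intro disjI1 exI[of _ "Suc y"]) simp
      qed
    qed
    then show ?thesis
      using False by simp
  qed
qed

theorem theorem11:
  fixes N :: real
  shows "(\<forall>k::nat. k \<ge> 1 \<longrightarrow> payoff N [2 * k + 1, 2 * k, 1] = F k N) \<and>
    (\<forall>(k::nat) (x::nat). k \<ge> 1 \<longrightarrow> x \<ge> 2 * k + 2 \<longrightarrow>
      payoff N [x, 2 * k, 1]
        = max (F k N) (- 2 * real k + \<bar>N\<bar>) + real x - 2 * real k - 1) \<and>
    (\<forall>(k::nat) (x::nat). k \<ge> 1 \<longrightarrow> x \<ge> 2 * k + 2 \<longrightarrow>
      payoff N [x, 2 * k + 1, 1]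
        = max (F k N) (- (2 * real k - 2) + \<bar>N\<bar>) + real x - 2 * real k - 2)"
proof (intro conjI allI impI)
  fix k :: nat
  assume k: "k \<ge> 1"
  then show "payoff N [2 * k + 1, 2 * k, 1] = F k N"
    using payoff_three_piles[of "2 * k" "2 * k + 1" N] by (simp add: surplus_def)
  fix x :: nat
  assume x: "x \<ge> 2 * k + 2"
  show "payoff N [x, 2 * k, 1]
      = max (F k N) (- 2 * real k + \<bar>N\<bar>) + real x - 2 * real k - 1"
    using payoff_three_piles[of "2 * k" x N] k x
    by (simp add: surplus_def excess_even_pile)
  show "payoff N [x, 2 * k + 1, 1]
      = max (F k N) (- (2 * real k - 2) + \<bar>N\<bar>) + real x - 2 * real k - 2"
    using payoff_three_piles[of "2 * k + 1" x N] k x excess_odd_pile[OF k, of N]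
    by (simp add: surplus_def)
qed

end
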